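(* Let $\lambda\in\mathbb{R}^d$ be a vector with nonnegative decreasing entries, $t_0=\operatorname{tr}\lambda$ and $t\in[t_0,+\infty)$. Fix $m\in\mathbb{Z}$ such that $m<d$. Then the vector $\nu_{\lambda,m}(t)$ defined in the context is the unique element of $\Lambda_t(\lambda,m)$ such that $$\nu_{\lambda,m}(t)\prec_w\mu\quad\text{for every }\mu\in\Lambda_t(\lambda,m).$$
   Context: $\operatorname{tr}$ of a vector is the sum of its entries; $\mathbf{1}_q$ is the all-ones vector of length $q$. $\mathbb{R}_+^{d\,\downarrow}$ is the set of vectors in $\mathbb{R}^d$ with nonnegative decreasing entries. $x\prec_w y$ means $\sum_{i=1}^kx_i^\downarrow\le\sum_{i=1}^ky_i^\downarrow$ for $k=1,\dots,d$, where $\downarrow$ denotes decreasing rearrangement. For an integer $m<d$ let $\Lambda(\lambda,m)=\{\mu\in\mathbb{R}_+^{d\,\downarrow}:\mu_i\ge\lambda_i,\ 1\le i\le d\}$ if $m\le0$, and $\Lambda(\lambda,m)=\{\mu\in\mathbb{R}_+^{d\,\downarrow}:\mu_i\ge\lambda_i\ (1\le i\le d),\ \mu_{d-m+i}\le\lambda_i\ (1\le i\le m)\}$ if $m\ge1$. For $t\ge t_0$, $\Lambda_t(\lambda,m)=\{\mu\in\Lambda(\lambda,m):\operatorname{tr}\mu\ge t\}$. For $t\ge t_0$ and $q\in\{0,\dots,d-1\}$ let $p_\lambda(q,t)=\frac{t-\sum_{j=1}^q\lambda_j}{d-q}$, and $$r_\lambda(t)=\min\{q\in\{0,\dots,d-1\}:p_\lambda(q,t)\ge\lambda_{q+1}\},\qquad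 c_\lambda(t)=p_\lambda(r_\lambda(t),t).$$ For $1\le m\le d-1$ let $s^*=\sum_{i=1}^m\lambda_i+(d-m)\lambda_m$, $s^{**}=(d-m)\lambda_1+\sum_{j=1}^m\lambda_j$, and for $t\ge t_0$ $$c_{\lambda,m}(t)=\begin{cases}c_\lambda(t)& t\le s^*\\ \lambda_m+\frac{t-s^*}{d-m}& t>s^*\end{cases},\qquad r_{\lambda,m}(t)=\min\{q\in\{0,\dots,d-1\}:c_{\lambda,m}(t)\ge\lambda_{q+1}\}.$$ For $m\le0$ set $c_{\lambda,m}=c_\lambda$ and $r_{\lambda,m}=r_\lambda$. With $c=c_{\lambda,m}(t)$ and $r=r_{\lambda,m}(t)$, the vector $\nu_{\lambda,m}(t)$ is: $(\lambda_1,\dots,\lambda_r,c\,\mathbf{1}_{d-r})$ if $m\le0$, or if $m\ge1$ and $t\le s^*$; $(\lambda_1,\dots,\lambda_r,c\,\mathbf{1}_{d-m},\lambda_{r+1},\dots,\lambda_m)$ if $m\ge1$ and $s^*<t<s^{**}$; $(c\,\mathbf{1}_{d-m},\lambda_1,\dots,\lambda_m)$ if $m\ge1$ and $t\ge s^{**}$. *)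

theory Defs
  imports Complex_Main
begin

text \<open>
  Vectors of \<open>\<real>\<^sup>d\<close> are represented by real lists of length \<open>d\<close>. Lists are indexed from \<open>0\<close>, so the
  entry with (one-based) index \<open>i\<close> of \<open>x\<close> is \<open>x ! (i - 1)\<close>, and \<open>sum_list (take k x)\<close> is the sum of
  the entries with one-based indices \<open>1, \<dots>, k\<close>. The dimension \<open>d\<close> is \<open>length l\<close> whenever a vector \<open>l\<close>
  (the \<open>\<lambda>\<close> of the mathematical text) is an argument.
\<close>

definition nonneg_decr :: "nat \<Rightarrow> real list set" where
  "nonneg_decr d = {x. length x = d \<and> (\<forall>i<d. 0 \<le> x ! i) \<and> sorted_wrt (\<ge>) x}"

definition decr_rearr :: "real list \<Rightarrow> real list" where
  "decr_rearr x = rev (sort x)"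

definition wmaj :: "real list \<Rightarrow> real list \<Rightarrow> bool" (infix "\<prec>\<^sub>w" 50) where
  "x \<prec>\<^sub>w y \<longleftrightarrow> length x = length y \<and>
     (\<forall>k\<in>{1..length x}.
        sum_list (take k (decr_rearr x)) \<le> sum_list (take k (decr_rearr y)))"

text \<open>
  For \<open>m \<ge> 1\<close> the second family of constraints reads \<open>\<mu>\<^bsub>d-m+i\<^esub> \<le> \<lambda>\<^sub>i\<close> for one-based
  \<open>1 \<le> i \<le> m\<close>; shifting both indices by one gives the form below.
\<close>

definition Lam :: "real list \<Rightarrow> int \<Rightarrow> real list set" where
  "Lam l m =
     (let d = length l in
      if m \<le> 0 then {\<mu> \<in> nonneg_decr d. \<forall>i<d. \<mu> ! i \<ge> l ! i}
      else {\<mu> \<in> nonneg_decr d. (\<forall>i<d. \<mu> ! i \<ge> l ! i) \<and>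
              (\<forall>i<nat m. \<mu> ! (d - nat m + i) \<le> l ! i)})"

definition Lam_t :: "real list \<Rightarrow> int \<Rightarrow> real \<Rightarrow> real list set" where
  "Lam_t l m t = {\<mu> \<in> Lam l m. sum_list \<mu> \<ge> t}"

definition p_lam :: "real list \<Rightarrow> nat \<Rightarrow> real \<Rightarrow> real" where
  "p_lam l q t = (t - sum_list (take q l)) / (real (length l) - real q)"

text \<open>
  The sets whose minimum is taken in \<open>r_lam\<close> and \<open>r_lam_m\<close> are nonempty for \<open>t \<ge> sum_list l\<close> when
  \<open>l\<close> is a nonempty decreasing list (and \<open>m < length l\<close>); only such arguments are meaningful.
\<close>

definition r_lam :: "real list \<Rightarrow> real \<Rightarrow> nat" where
  "r_lam l t = Min {q \<in> {..<length l}. p_lam l q t \<ge> l ! q}"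

definition c_lam :: "real list \<Rightarrow> real \<Rightarrow> real" where
  "c_lam l t = p_lam l (r_lam l t) t"

text \<open>The thresholds \<open>s\<^sup>*\<close> and \<open>s\<^sup>*\<^sup>*\<close>, meaningful for \<open>1 \<le> m \<le> length l - 1\<close>.\<close>

definition s_star :: "real list \<Rightarrow> nat \<Rightarrow> real" where
  "s_star l m = sum_list (take m l) + (real (length l) - real m) * l ! (m - 1)"

definition s_star2 :: "real list \<Rightarrow> nat \<Rightarrow> real" where
  "s_star2 l m = (real (length l) - real m) * l ! 0 + sum_list (take m l)"

definition c_lam_m :: "real list \<Rightarrow> int \<Rightarrow> real \<Rightarrow> real" where
  "c_lam_m l m t =
     (if m \<le> 0 \<or> t \<le> s_star l (nat m) then c_lam l t
      else l ! (nat m - 1) + (t - s_star l (nat m)) / (real (length l) - real (nat m)))"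

definition r_lam_m :: "real list \<Rightarrow> int \<Rightarrow> real \<Rightarrow> nat" where
  "r_lam_m l m t =
     (if m \<le> 0 then r_lam l t
      else Min {q \<in> {..<length l}. c_lam_m l m t \<ge> l ! q})"

definition nu :: "real list \<Rightarrow> int \<Rightarrow> real \<Rightarrow> real list" where
  "nu l m t =
     (let d = length l; c = c_lam_m l m t; r = r_lam_m l m t in
      if m \<le> 0 \<or> t \<le> s_star l (nat m)
        then take r l @ replicate (d - r) c
      else if t < s_star2 l (nat m)
        then take r l @ replicate (d - nat m) c @ drop r (take (nat m) l)
      else replicate (d - nat m) c @ take (nat m) l)"

end

theory Submission
  imports Defs "HOL-Library.Multiset"
begin

text \<open>
  In every case \<open>\<nu>\<close> is the constant vector \<open>c\<close> clamped between the lower bounds \<open>\<lambda>\<^sub>i\<close> and the upper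
  bounds that define the feasible set, and \<open>c\<close> is such that \<open>tr \<nu> = t\<close>. Hence it has a head that
  agrees with the lower bounds, a plateau \<open>c\<close>, and a tail that agrees with the upper bounds. For a
  decreasing feasible \<open>\<mu>\<close> the difference \<open>\<mu> - \<nu>\<close> is nonnegative on the head, decreasing on the
  plateau and nonpositive on the tail, so it changes sign at most once, from plus to minus. As its
  total sum is nonnegative, all its partial sums are. Uniqueness is the antisymmetry of weak
  majorization on decreasing vectors.
\<close>

section \<open>Decreasing vectors and their weak majorization\<close>

lemma sum_list_take_nth:
  fixes x :: "real list"
  assumes "k \<le> length x"
  shows "sum_list (take k x) = (\<Sum>i<k. x ! i)"
  using assms by (simp add: sum_list_sum_nth atLeast0LessThan min_absorb2)

lemma decr_rearr_decreasing:
  assumes "sorted_wrt (\<ge>) x"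
  shows "decr_rearr x = x"
proof -
  have "sorted (rev x)"
    using assms by (simp add: sorted_wrt_rev)
  then have "sort (rev x) = rev x"
    by (rule sorted_sort_id)
  moreover have "sort (rev x) = sort x"
    by (rule properties_for_sort) simp_all
  ultimately show ?thesis
    by (simp add: decr_rearr_def)
qed

lemma nonneg_decr_length: "x \<in> nonneg_decr d \<Longrightarrow> length x = d"
  by (simp add: nonneg_decr_def)

lemma nonneg_decr_nonneg: "x \<in> nonneg_decr d \<Longrightarrow> i < d \<Longrightarrow> 0 \<le> x ! i"
  by (simp add: nonneg_decr_def)

lemma nonneg_decr_antimono:
  assumes "x \<in> nonneg_decr d" "i \<le> j" "j < d"
  shows "x ! j \<le> x ! i"
  using assms by (cases "i = j") (auto simp: nonneg_decr_def sorted_wrt_iff_nth_less)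

lemma nonneg_decrI:
  assumes "length x = d" "\<And>i. i < d \<Longrightarrow> 0 \<le> x ! i"
    and "\<And>i j. i < j \<Longrightarrow> j < d \<Longrightarrow> x ! j \<le> x ! i"
  shows "x \<in> nonneg_decr d"
  using assms by (auto simp: nonneg_decr_def sorted_wrt_iff_nth_less)

text \<open>Decreasing vectors are their own rearrangements, so from here on only plain partial sums
  matter; the case \<open>k = 0\<close> is an empty sum and is added for convenience.\<close>

lemma wmaj_nonneg_decr_iff:
  assumes "x \<in> nonneg_decr d" "y \<in> nonneg_decr d"
  shows "x \<prec>\<^sub>w y \<longleftrightarrow> (\<forall>k\<le>d. (\<Sum>i<k. x ! i) \<le> (\<Sum>i<k. y ! i))"
proof -
  have len: "length x = d" "length y = d"
    and sorted: "sorted_wrt (\<ge>) x" "sorted_wrt (\<ge>) y"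
    using assms by (auto simp: nonneg_decr_def)
  have "x \<prec>\<^sub>w y \<longleftrightarrow> (\<forall>k\<in>{1..d}. (\<Sum>i<k. x ! i) \<le> (\<Sum>i<k. y ! i))"
    using len by (auto simp: wmaj_def decr_rearr_decreasing sorted sum_list_take_nth)
  also have "\<dots> \<longleftrightarrow> (\<forall>k\<le>d. (\<Sum>i<k. x ! i) \<le> (\<Sum>i<k. y ! i))"
    by (auto simp: Ball_def) (metis Suc_leI lessThan_0 neq0_conv order_refl sum.empty)
  finally show ?thesis .
qed

text \<open>All partial sums agree, and each entry is the difference of two consecutive
  ones.\<close>

lemma wmaj_antisym:
  assumes x: "x \<in> nonneg_decr d" and y: "y \<in> nonneg_decr d"
    and "x \<prec>\<^sub>w y" "y \<prec>\<^sub>w x"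
  shows "x = y"
proof (rule nth_equalityI)
  show "length x = length y"
    using x y by (simp add: nonneg_decr_length)
  have eq: "(\<Sum>i<k. x ! i) = (\<Sum>i<k. y ! i)" if "k \<le> d" for k
    using assms that by (meson antisym wmaj_nonneg_decr_iff)
  fix i assume "i < length x"
  then have "i < d"
    using x by (simp add: nonneg_decr_length)
  then show "x ! i = y ! i"
    using eq[of i] eq[of "Suc i"] by simp
qed

text \<open>At each cut \<open>k\<close> either \<open>y - x\<close> is nonnegative before
  \<open>k\<close>, and the partial sum is compared entrywise, or it is nonpositive from
  \<open>k\<close> on, and the comparison follows from the totals by subtracting the
  remainder.\<close>

lemma wmaj_plateau:
  assumes x: "x \<in> nonneg_decr d" and y: "y \<in> nonneg_decr d"
    and head: "\<And>i. i < a \<Longrightarrow> i < d \<Longrightarrow> x ! i \<le> y ! i"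
    and plateau: "\<And>i. a \<le> i \<Longrightarrow> i < b \<Longrightarrow> i < d \<Longrightarrow> x ! i = c"
    and tail: "\<And>i. b \<le> i \<Longrightarrow> i < d \<Longrightarrow> y ! i \<le> x ! i"
    and total: "sum_list x \<le> sum_list y"
  shows "x \<prec>\<^sub>w y"
proof -
  have total': "(\<Sum>i<d. x ! i) \<le> (\<Sum>i<d. y ! i)"
    using total x y by (simp add: sum_list_sum_nth atLeast0LessThan nonneg_decr_length)
  have "(\<Sum>i<k. x ! i) \<le> (\<Sum>i<k. y ! i)" if k: "k \<le> d" for k
  proof -
    have "(\<forall>i<k. x ! i \<le> y ! i) \<or> (\<forall>i\<in>{k..<d}. y ! i \<le> x ! i)"
    \<comment> \<open>If \<open>k\<close> lies on the plateau, the sign of \<open>y ! k - c\<close>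
      decides: \<open>y\<close> is decreasing, so the comparison at \<open>k\<close> carries over to
      all earlier or all later plateau entries.\<close>
    proof (cases "k < a \<or> (k < b \<and> k < d \<and> x ! k \<le> y ! k)")
      case True
      have "x ! i \<le> y ! i" if i: "i < k" for i
      proof (cases "i < a")
        case False
        with True i have "x ! i = x ! k" "x ! k \<le> y ! k" "k < d"
          using plateau[of i] plateau[of k] by auto
        then show ?thesis
          using nonneg_decr_antimono[OF y, of i k] i by simp
      qed (use head i k in auto)
      then show ?thesis by blast
    next
      case False
      have "y ! i \<le> x ! i" if i: "i \<in> {k..<d}" for i
      proof (cases "i < b")
        case True
        with False i have "x ! i = x ! k" "y ! k \<le> x ! k"
          using plateau[of i] plateau[of k] by auto
        then show ?thesis
          using nonneg_decr_antimono[OF y, of k i] i by simp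
      qed (use tail i in auto)
      then show ?thesis by blast
    qed
    then show ?thesis
    proof
      assume "\<forall>i<k. x ! i \<le> y ! i"
      then show ?thesis by (intro sum_mono) simp
    next
      assume "\<forall>i\<in>{k..<d}. y ! i \<le> x ! i"
      then have "(\<Sum>i=k..<d. y ! i) \<le> (\<Sum>i=k..<d. x ! i)"
        by (intro sum_mono) simp
      moreover have "(\<Sum>i<d. f i) = (\<Sum>i<k. f i) + (\<Sum>i=k..<d. f i)" for f :: "nat \<Rightarrow> real"
        using sum.atLeastLessThan_concat[of 0 k d f] k by (simp add: atLeast0LessThan)
      ultimately show ?thesis
        using total' by simp
    qed
  qed
  then show ?thesis
    using wmaj_nonneg_decr_iff[OF x y] by blast
qed

section \<open>Vectors with a plateau\<close>

text \<open>All three shapes of \<open>\<nu>\<close> are instances; the shape without a tail is \<open>M = r\<close>.\<close>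

definition plateau_vec :: "real list \<Rightarrow> nat \<Rightarrow> nat \<Rightarrow> real \<Rightarrow> real list" where
  "plateau_vec l r M c = take r l @ replicate (length l - M) c @ drop r (take M l)"

lemma length_plateau_vec:
  assumes "r \<le> M" "M < length l"
  shows "length (plateau_vec l r M c) = length l"
  using assms by (simp add: plateau_vec_def)

lemma plateau_vec_nth:
  assumes "r \<le> M" "M < length l" "i < length l"
  shows "plateau_vec l r M c ! i =
    (if i < r then l ! i else if i < r + (length l - M) then c else l ! (i - (length l - M)))"
  using assms by (auto simp: plateau_vec_def nth_append)

text \<open>The plateau is inserted into \<open>take M l\<close> at position \<open>r\<close>, so
  the total does not depend on \<open>r\<close>.\<close>

lemma sum_list_plateau_vec:
  assumes "r \<le> M" "M < length l"
  shows "sum_list (plateau_vec l r M c)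
    = sum_list (take M l) + (real (length l) - real M) * c"
proof -
  have "take r (take M l) = take r l"
    using assms by (simp add: min_def)
  then have "sum_list (take M l) = sum_list (take r l) + sum_list (drop r (take M l))"
    by (metis append_take_drop_id sum_list_append)
  then show ?thesis
    using assms by (simp add: plateau_vec_def sum_list_replicate of_nat_diff)
qed

text \<open>Tail entries are entries of \<open>l\<close> moved to the right by \<open>d - M\<close>,
  and \<open>l\<close> is decreasing.\<close>

lemma plateau_vec_ge:
  assumes l: "l \<in> nonneg_decr d" and rM: "r \<le> M" "M < d"
    and low: "\<And>i. r \<le> i \<Longrightarrow> i < d \<Longrightarrow> l ! i \<le> c"
    and i: "i < d"
  shows "l ! i \<le> plateau_vec l r M c ! i"
  using rM i low[of i] nonneg_decr_antimono[OF l, of "i - (d - M)" i]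
  by (simp add: plateau_vec_nth nonneg_decr_length[OF l])

text \<open>Since \<open>l\<close> crosses the level \<open>c\<close> exactly at position
  \<open>r\<close>, inserting copies of \<open>c\<close> there keeps the order.\<close>

lemma plateau_vec_nonneg_decr:
  assumes l: "l \<in> nonneg_decr d" and rM: "r \<le> M" "M < d"
    and high: "\<And>i. i < r \<Longrightarrow> c < l ! i"
    and low: "\<And>i. r \<le> i \<Longrightarrow> i < d \<Longrightarrow> l ! i \<le> c"
  shows "plateau_vec l r M c \<in> nonneg_decr d"
proof (rule nonneg_decrI)
  note len = nonneg_decr_length[OF l]
  show "length (plateau_vec l r M c) = d"
    using rM len by (simp add: length_plateau_vec)
  show "0 \<le> plateau_vec l r M c ! i" if "i < d" for i
    using plateau_vec_ge[OF l rM low that] nonneg_decr_nonneg[OF l that] by linarith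
  show "plateau_vec l r M c ! j \<le> plateau_vec l r M c ! i" if ij: "i < j" "j < d" for i j
  proof -
    have "j - (d - M) < d" "i \<le> j"
      using ij rM by auto
    then show ?thesis
      using ij rM high[of i] low[of j] low[of "j - (d - M)"]
        nonneg_decr_antimono[OF l, of i j] nonneg_decr_antimono[OF l, of i "j - (d - M)"]
        nonneg_decr_antimono[OF l, of "i - (d - M)" "j - (d - M)"]
      by (auto simp: plateau_vec_nth len)
  qed
qed

lemma Lam_t_iff:
  assumes "l \<in> nonneg_decr d"
  shows "\<mu> \<in> Lam_t l m t \<longleftrightarrow> \<mu> \<in> nonneg_decr d \<and> (\<forall>i<d. l ! i \<le> \<mu> ! i) \<and>
    (\<forall>i<nat m. \<mu> ! (d - nat m + i) \<le> l ! i) \<and> t \<le> sum_list \<mu>"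
  using nonneg_decr_length[OF assms] by (auto simp: Lam_t_def Lam_def Let_def)

text \<open>The assumption \<open>shape\<close> covers two situations: for \<open>M = nat m\<close>
  the tail consists of the upper bounds themselves; for \<open>M = r\<close> there is no tail, and
  the upper bounds hold because \<open>c\<close> lies below them.\<close>

lemma plateau_vec_least:
  assumes l: "l \<in> nonneg_decr d" and m: "m < int d" and rM: "r \<le> M" "M < d"
    and high: "\<And>i. i < r \<Longrightarrow> c < l ! i"
    and low: "\<And>i. r \<le> i \<Longrightarrow> i < d \<Longrightarrow> l ! i \<le> c"
    and shape: "M = nat m \<or> M = r \<and> (\<forall>i<nat m. c \<le> l ! i)"
    and total: "sum_list (take M l) + (real d - real M) * c = t"
  shows "plateau_vec l r M c \<in> Lam_t l m t \<and>
    (\<forall>\<mu>\<in>Lam_t l m t. plateau_vec l r M c \<prec>\<^sub>w \<mu>)"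
proof
  note len = nonneg_decr_length[OF l]
  let ?v = "plateau_vec l r M c"
  have sum: "sum_list ?v = t"
    using rM total by (simp add: sum_list_plateau_vec len)
  have v: "?v \<in> nonneg_decr d"
    by (rule plateau_vec_nonneg_decr[OF l rM high low])
  have "?v ! (d - nat m + i) \<le> l ! i" if i: "i < nat m" for i
  proof -
    have "d - nat m + i < d" "nat m < d"
      \<comment> \<open>For \<open>M = nat m\<close> this separates the tail, where the upper bound
        is attained, from the entries before it, which are bounded through \<open>high\<close> or
        the monotonicity of \<open>l\<close>.\<close>
      and "d + i - nat m < r + d - nat m \<longleftrightarrow> i < r"
      using i m by auto
    then show ?thesis
      using i rM shape high[of i] nonneg_decr_antimono[OF l, of i "d - nat m + i"]
      by (auto simp: plateau_vec_nth len)
  qed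
  then show "?v \<in> Lam_t l m t"
    using v sum plateau_vec_ge[OF l rM low] by (auto simp: Lam_t_iff[OF l])
  show "\<forall>\<mu>\<in>Lam_t l m t. ?v \<prec>\<^sub>w \<mu>"
  proof
    fix \<mu> assume "\<mu> \<in> Lam_t l m t"
    then have \<mu>: "\<mu> \<in> nonneg_decr d" and lower: "\<And>i. i < d \<Longrightarrow> l ! i \<le> \<mu> ! i"
      and upper: "\<And>i. i < nat m \<Longrightarrow> \<mu> ! (d - nat m + i) \<le> l ! i" and "t \<le> sum_list \<mu>"
      by (auto simp: Lam_t_iff[OF l])
    show "?v \<prec>\<^sub>w \<mu>"
    proof (rule wmaj_plateau[OF v \<mu>, where a = r and b = "r + (d - M)" and c = c])
      show "\<mu> ! i \<le> ?v ! i" if i: "r + (d - M) \<le> i" "i < d" for i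
      proof -
        \<comment> \<open>With \<open>M = r\<close> the tail would start at \<open>d\<close>, so the
          existence of \<open>i\<close> excludes that shape.\<close>
        have M: "M = nat m"
          using shape i rM by auto
        have "\<not> i < r" "\<not> i < r + (d - M)"
          using i by auto
        then have "?v ! i = l ! (i - (d - M))"
          unfolding plateau_vec_nth[OF rM[folded len] i(2)[folded len]] len by (simp only: if_False)
        moreover have "i - (d - M) < nat m" "d - nat m + (i - (d - M)) = i"
          using i rM M by auto
        ultimately show ?thesis
          using upper[of "i - (d - M)"] by simp
      qed
    qed (use rM lower sum \<open>t \<le> sum_list \<mu>\<close> in \<open>auto simp: plateau_vec_nth len\<close>)
  qed
qed

section \<open>The level \<open>c\<close> and the index where \<lambda> crosses it\<close>

text \<open>As \<open>l\<close> is decreasing, the indices with \<open>l ! q \<le> c\<close> form a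
  final segment of \<open>{..<d}\<close>; the given \<open>q\<close> makes it nonempty, so that
  \<open>Min\<close> is meaningful.\<close>

lemma Min_index_le:
  assumes l: "l \<in> nonneg_decr d" and q: "q < d" "l ! q \<le> c"
  defines "r \<equiv> Min {q \<in> {..<d}. c \<ge> l ! q}"
  shows "r \<le> q" "\<And>i. i < r \<Longrightarrow> c < l ! i" "\<And>i. r \<le> i \<Longrightarrow> i < d \<Longrightarrow> l ! i \<le> c"
proof -
  let ?S = "{q \<in> {..<d}. c \<ge> l ! q}"
  have "finite ?S" "q \<in> ?S"
    using q by auto
  then have r: "r \<in> ?S" and least: "\<And>i. i \<in> ?S \<Longrightarrow> r \<le> i"
    unfolding r_def using Min_in[of ?S] by (auto intro: Min_le)
  show "r \<le> q"
    using least \<open>q \<in> ?S\<close> by blast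
  show "c < l ! i" if "i < r" for i
    using least[of i] r that by force
  show "l ! i \<le> c" if "r \<le> i" "i < d" for i
    using r nonneg_decr_antimono[OF l that] by auto
qed

text \<open>\<open>p_lam l q t\<close> is a weighted mean of \<open>l ! q\<close> and
  \<open>p_lam l (Suc q) t\<close> with weights proportional to \<open>1\<close> and
  \<open>d - q - 1\<close>, where \<open>d = length l\<close>; if the mean is below
  \<open>l ! q\<close>, so is the other term.\<close>

lemma p_lam_Suc_less:
  assumes q: "Suc q < length l" and less: "p_lam l q t < l ! q"
  shows "p_lam l (Suc q) t < l ! q"
proof -
  have "t - sum_list (take q l) < l ! q * (real (length l) - real q)"
    using less q by (simp add: p_lam_def pos_divide_less_eq)
  then show ?thesis
    using q by (simp add: p_lam_def pos_divide_less_eq take_Suc_conv_app_nth algebra_simps)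
qed

lemma r_lam_props:
  assumes d: "d \<ge> 1" and l: "l \<in> nonneg_decr d" and t: "t \<ge> sum_list l"
  shows "r_lam l t < d"
    and "\<And>i. i < r_lam l t \<Longrightarrow> c_lam l t < l ! i"
    and "\<And>i. r_lam l t \<le> i \<Longrightarrow> i < d \<Longrightarrow> l ! i \<le> c_lam l t"
    and "sum_list (take (r_lam l t) l) + (real d - real (r_lam l t)) * c_lam l t = t"
proof -
  note len = nonneg_decr_length[OF l]
  let ?S = "{q \<in> {..<length l}. p_lam l q t \<ge> l ! q}" and ?r = "r_lam l t"
  have "sum_list l = sum_list (take (d - 1) l) + l ! (d - 1)"
    using arg_cong[OF take_Suc_conv_app_nth[of "d - 1" l], of sum_list] d len by simp
  \<comment> \<open>At the last index the denominator is \<open>1\<close>, and the condition reduces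
    to \<open>t \<ge> sum_list l\<close>.\<close>
  then have "d - 1 \<in> ?S"
    using t d len by (simp add: p_lam_def of_nat_diff)
  then have r: "?r \<in> ?S" and least: "\<And>i. i \<in> ?S \<Longrightarrow> ?r \<le> i"
    unfolding r_lam_def using Min_in[of ?S] by (auto intro: Min_le)
  then show rd: "?r < d"
    by (simp add: len)
  show "c_lam l t < l ! i" if i: "i < ?r" for i
  proof -
    \<comment> \<open>Minimality is used only at the predecessor of \<open>?r\<close>; smaller
      indices follow by monotonicity of \<open>l\<close>.\<close>
    obtain q where q: "?r = Suc q"
      using i by (cases ?r) auto
    then have "q \<notin> ?S"
      using least[of q] by auto
    then have "p_lam l q t < l ! q"
      using q rd len by auto
    then have "c_lam l t < l ! q"
      using p_lam_Suc_less[of q l t] q rd len by (simp add: c_lam_def)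
    also have "\<dots> \<le> l ! i"
      using nonneg_decr_antimono[OF l, of i q] i q rd by simp
    finally show ?thesis .
  qed
  show "l ! i \<le> c_lam l t" if "?r \<le> i" "i < d" for i
    using r nonneg_decr_antimono[OF l that] by (auto simp: c_lam_def)
  show "sum_list (take ?r l) + (real d - real ?r) * c_lam l t = t"
    using rd len by (simp add: c_lam_def p_lam_def)
qed

text \<open>Reconciles two definitions of the index: \<open>r_lam\<close> tests a level that varies
  with \<open>q\<close>, while \<open>r_lam_m\<close> for positive \<open>m\<close> tests the fixed
  level \<open>c\<close>.\<close>

lemma r_lam_eq_Min:
  assumes "d \<ge> 1" "l \<in> nonneg_decr d" "t \<ge> sum_list l"
  shows "Min {q \<in> {..<d}. c_lam l t \<ge> l ! q} = r_lam l t"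
  using r_lam_props[OF assms] by (intro Min_eqI) (auto simp: not_less[symmetric])

text \<open>Up to \<open>s_star\<close> the upper bounds are not violated by the plateau. If
  \<open>r_lam l t < n\<close>, replacing the entries of \<open>l\<close> from that index up to
  \<open>n\<close> by the larger \<open>c_lam l t\<close> in \<open>t \<le> s_star l n\<close>
  leaves a comparison of the last \<open>d - n\<close> terms.\<close>

lemma c_lam_le_of_le_s_star:
  assumes d: "d \<ge> 1" and l: "l \<in> nonneg_decr d" and t: "t \<ge> sum_list l"
    and n: "1 \<le> n" "n < d" and le: "t \<le> s_star l n"
  shows "c_lam l t \<le> l ! (n - 1)"
proof (cases "n \<le> r_lam l t")
  case True
  then have "n - 1 < r_lam l t"
    using n by simp
  then show ?thesis
    using r_lam_props(2)[OF d l t] by (simp add: less_imp_le)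
next
  case False
  note len = nonneg_decr_length[OF l]
  let ?r = "r_lam l t" and ?c = "c_lam l t"
  have r: "?r < n" using False by simp
  have "sum_list (take n l) = (\<Sum>i<?r. l ! i) + (\<Sum>i=?r..<n. l ! i)"
    using sum.atLeastLessThan_concat[of 0 ?r n "\<lambda>i. l ! i"] r n len
    by (simp add: sum_list_take_nth atLeast0LessThan)
  also have "(\<Sum>i<?r. l ! i) = sum_list (take ?r l)"
    using r n len by (simp add: sum_list_take_nth)
  also have "(\<Sum>i=?r..<n. l ! i) \<le> (real n - real ?r) * ?c"
    using sum_bounded_above[of "{?r..<n}" "\<lambda>i. l ! i" ?c] r_lam_props(3)[OF d l t] r n
    by (simp add: of_nat_diff)
  finally have "t \<le> sum_list (take ?r l) + (real n - real ?r) * ?c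
      + (real d - real n) * l ! (n - 1)"
    using le len by (simp add: s_star_def)
  then have "(real d - real n) * ?c \<le> (real d - real n) * l ! (n - 1)"
    using r_lam_props(4)[OF d l t] by (simp add: algebra_simps)
  then show ?thesis
    using n by simp
qed

section \<open>The least element and its uniqueness\<close>

lemma nu_least:
  assumes d: "d \<ge> 1" and l: "l \<in> nonneg_decr d" and t: "t \<ge> sum_list l" and m: "m < int d"
  shows "nu l m t \<in> Lam_t l m t \<and> (\<forall>\<mu>\<in>Lam_t l m t. nu l m t \<prec>\<^sub>w \<mu>)"
proof (cases "m \<le> 0 \<or> t \<le> s_star l (nat m)")
  case True
  note len = nonneg_decr_length[OF l]
  have c: "c_lam_m l m t = c_lam l t"
    using True by (auto simp: c_lam_m_def)
  have "r_lam_m l m t = r_lam l t"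
    using r_lam_eq_Min[OF d l t] by (auto simp: r_lam_m_def c len)
  then have nu: "nu l m t = plateau_vec l (r_lam l t) (r_lam l t) (c_lam l t)"
    using True c by (simp add: nu_def plateau_vec_def Let_def)
  \<comment> \<open>This is the second alternative of \<open>shape\<close>; it is vacuous for
    \<open>m \<le> 0\<close>.\<close>
  have "c_lam l t \<le> l ! i" if i: "i < nat m" for i
  proof -
    have "c_lam l t \<le> l ! (nat m - 1)"
      using c_lam_le_of_le_s_star[OF d l t, of "nat m"] i True m by auto
    also have "\<dots> \<le> l ! i"
      using nonneg_decr_antimono[OF l, of i "nat m - 1"] i m by auto
    finally show ?thesis .
  qed
  then show ?thesis
    unfolding nu using r_lam_props[OF d l t] by (intro plateau_vec_least[OF l m]) auto
next
  case False
  note len = nonneg_decr_length[OF l]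
  define n c r where "n = nat m" and "c = c_lam_m l m t" and "r = r_lam_m l m t"
  have n: "1 \<le> n" "n < d" and gt: "t > s_star l n"
    using False m by (auto simp: n_def)
  have c_eq: "c = l ! (n - 1) + (t - s_star l n) / (real d - real n)"
    using False by (simp add: c_def c_lam_m_def n_def len)
  have r_eq: "r = Min {q \<in> {..<d}. c \<ge> l ! q}"
    using False by (simp add: r_def r_lam_m_def c_def len)
  \<comment> \<open>By the definition of \<open>s_star\<close>, the excess
    \<open>t - s_star l n\<close> is spread evenly over the \<open>d - n\<close> plateau
    entries.\<close>
  have total: "sum_list (take n l) + (real d - real n) * c = t"
    using n by (simp add: c_eq s_star_def len field_simps)
  have "l ! (n - 1) \<le> c"
    using gt n by (simp add: c_eq)
  moreover have "n - 1 < d"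
    using n by simp
  ultimately have r: "r \<le> n - 1" "\<And>i. i < r \<Longrightarrow> c < l ! i" "\<And>i. r \<le> i \<Longrightarrow> i < d \<Longrightarrow> l ! i \<le> c"
    using Min_index_le[OF l, of "n - 1" c] unfolding r_eq by blast+
  \<comment> \<open>From \<open>s_star2\<close> on, the level reaches the largest entry of
    \<open>l\<close>, so the head is empty and the third shape of \<open>nu\<close> is the second
    one with \<open>r = 0\<close>.\<close>
  have "r = 0" if "t \<ge> s_star2 l n"
  proof -
    have "(real d - real n) * l ! 0 \<le> (real d - real n) * c"
      using that total by (simp add: s_star2_def len)
    then show ?thesis
      using r(2)[of 0] n by (cases r) auto
  qed
  then have "nu l m t = plateau_vec l r n c"
    using False by (auto simp: nu_def plateau_vec_def Let_def simp flip: n_def c_def r_def)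
  then show ?thesis
    using plateau_vec_least[OF l m, of r n c t] r n total n_def by auto
qed

theorem theorem5p16:
  fixes d :: nat and l :: "real list" and m :: int and t :: real
  assumes "d \<ge> 1"
    and "l \<in> nonneg_decr d"
    and "t \<ge> sum_list l"
    and "m < int d"
  shows "nu l m t \<in> Lam_t l m t \<and>
         (\<forall>\<mu>\<in>Lam_t l m t. nu l m t \<prec>\<^sub>w \<mu>) \<and>
         (\<forall>\<nu>\<in>Lam_t l m t. (\<forall>\<mu>\<in>Lam_t l m t. \<nu> \<prec>\<^sub>w \<mu>) \<longrightarrow> \<nu> = nu l m t)"
proof -
  \<comment> \<open>Two least elements are weakly majorized by each other, so antisymmetry
    applies.\<close>
  have "\<nu> = nu l m t"
    if "\<nu> \<in> Lam_t l m t" "\<forall>\<mu>\<in>Lam_t l m t. \<nu> \<prec>\<^sub>w \<mu>" for \<nu>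
    using that nu_least[OF assms] by (intro wmaj_antisym[of _ d]) (auto simp: Lam_t_iff[OF assms(2)])
  then show ?thesis
    using nu_least[OF assms] by blast
qed

end
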